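(* Let $(\mathcal{H},\Lambda)$ be a Hopf Galois order setting and let $F$ be an $\mathcal{H}$-Galois $\Lambda$-order. Then $\Lambda$ is a maximal commutative subalgebra of $F$.
   Context: Let $\Bbbk$ be an arbitrary field; all algebras are over $\Bbbk$ and $\otimes=\otimes_{\Bbbk}$. A Hopf Galois order setting (or setting) is a pair $(\mathcal{H},\Lambda)$ where $\mathcal{H}$ is a left coideal subalgebra (a subalgebra with $\Delta(\mathcal{H})\subset\tilde{\mathcal{H}}\otimes\mathcal{H}$) of a Hopf algebra $\tilde{\mathcal{H}}$ (which is part of the data) with comultiplication $\Delta(x)=x_{(1)}\otimes x_{(2)}$, counit $\varepsilon$ and invertible antipode $S$, and $\Lambda$ is a left $\tilde{\mathcal{H}}$-module algebra (action denoted $x\triangleright a$) such that (i) $\Lambda$ is a noetherian (commutative) integral domain; (ii) the action of $\tilde{\mathcal{H}}$ on $\Lambda$ extends to an action on the field of fractions $L=\mathrm{Frac}(\Lambda)$ (also denoted $\triangleright$); (iii) $\Lambda$ is faithful as a left module over the smash product $\Lambda\#\mathcal{H}$. The smash product $A\#\mathcal{H}$ (for $A=\Lambda$ or $L$) is the algebra containing $A$ and $\mathcal{H}$ as subalgebras such that $A\otimes\mathcal{H}\to A\#\mathcal{H}$, $a\otimes x\mapsto ax$, is a vector space isomorphism and $xa=(x_{(1)}\triangleright a)x_{(2)}$ for $x\in\mathcal{H}$, $a\in A$. For $X\in L\#\tilde{\mathcal{H}}$, $\hat X$ denotes the corresponding linear endomorphism of $L$, determined by $\hat f(g)=fg$ for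 $f,g\in L$ and $\hat x(f)=x\triangleright f$ for $x\in\tilde{\mathcal{H}}$. An $\mathcal{H}$-Galois $\Lambda$-order is a subalgebra $F\subset L\#\mathcal{H}$ such that $\Lambda\subset F$, $LF=L\#\mathcal{H}$, and $\hat X(\Lambda)\subset\Lambda$ for all $X\in F$. *)

theory Defs
  imports
    "HOL-Library.Poly_Mapping"
    "HOL-Computational_Algebra.Fraction_Field"
    "HOL-Algebra.Module"
    "HOL-Algebra.Ring_Divisibility"
begin

section \<open>Tensor products of vector spaces\<close>

text \<open>
  The scalar field is a type of class \<open>field\<close> and vector spaces over it are types with an
  explicit scalar multiplication. The free vector space on a type \<open>'i\<close> is the type of finitely
  supported functions \<open>'i \<Rightarrow>\<^sub>0 'k\<close>.
\<close>

definition free_scale :: "'k::field \<Rightarrow> ('i \<Rightarrow>\<^sub>0 'k) \<Rightarrow> ('i \<Rightarrow>\<^sub>0 'k)" where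
  "free_scale c p = Poly_Mapping.map ((*) c) p"

interpretation free: vector_space "free_scale :: 'k::field \<Rightarrow> ('i \<Rightarrow>\<^sub>0 'k) \<Rightarrow> ('i \<Rightarrow>\<^sub>0 'k)"
proof -
  have lookup_scale:
    "Poly_Mapping.lookup (free_scale c p) i = c * Poly_Mapping.lookup p i" for c :: 'k and p :: "'i \<Rightarrow>\<^sub>0 'k" and i
    by (simp add: free_scale_def Poly_Mapping.map.rep_eq when_def in_keys_iff)
  show "vector_space (free_scale :: 'k \<Rightarrow> ('i \<Rightarrow>\<^sub>0 'k) \<Rightarrow> ('i \<Rightarrow>\<^sub>0 'k))"
    by unfold_locales
      (auto intro!: poly_mapping_eqI simp: lookup_scale lookup_add algebra_simps)
qed

text \<open>The linear extension of \<open>f\<close>, defined on a basis, to the free vector space.\<close>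

definition free_lift :: "('k::field \<Rightarrow> 'v \<Rightarrow> 'v::ab_group_add) \<Rightarrow> ('i \<Rightarrow> 'v) \<Rightarrow> ('i \<Rightarrow>\<^sub>0 'k) \<Rightarrow> 'v" where
  "free_lift s f p = (\<Sum>i\<in>Poly_Mapping.keys p. s (Poly_Mapping.lookup p i) (f i))"

definition tensor_null ::
  "('k::field \<Rightarrow> 'v \<Rightarrow> 'v::ab_group_add) \<Rightarrow> ('k \<Rightarrow> 'w \<Rightarrow> 'w::ab_group_add) \<Rightarrow> ('v \<times> 'w \<Rightarrow>\<^sub>0 'k) set" where
  "tensor_null s1 s2 = free.span
     ({Poly_Mapping.single (v + v', w) 1 - Poly_Mapping.single (v, w) 1 - Poly_Mapping.single (v', w) 1 | v v' w. True} \<union>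
      {Poly_Mapping.single (v, w + w') 1 - Poly_Mapping.single (v, w) 1 - Poly_Mapping.single (v, w') 1 | v w w'. True} \<union>
      {Poly_Mapping.single (s1 c v, w) 1 - free_scale c (Poly_Mapping.single (v, w) 1) | c v w. True} \<union>
      {Poly_Mapping.single (v, s2 c w) 1 - free_scale c (Poly_Mapping.single (v, w) 1) | c v w. True})"

definition tensor_null3 ::
  "('k::field \<Rightarrow> 'v \<Rightarrow> 'v::ab_group_add) \<Rightarrow> ('v \<times> 'v \<times> 'v \<Rightarrow>\<^sub>0 'k) set" where
  "tensor_null3 s = free.span
     ({Poly_Mapping.single (u + u', v, w) 1 - Poly_Mapping.single (u, v, w) 1 - Poly_Mapping.single (u', v, w) 1 | u u' v w. True} \<union>
      {Poly_Mapping.single (u, v + v', w) 1 - Poly_Mapping.single (u, v, w) 1 - Poly_Mapping.single (u, v', w) 1 | u v v' w. True} \<union>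
      {Poly_Mapping.single (u, v, w + w') 1 - Poly_Mapping.single (u, v, w) 1 - Poly_Mapping.single (u, v, w') 1 | u v w w'. True} \<union>
      {Poly_Mapping.single (s c u, v, w) 1 - free_scale c (Poly_Mapping.single (u, v, w) 1) | c u v w. True} \<union>
      {Poly_Mapping.single (u, s c v, w) 1 - free_scale c (Poly_Mapping.single (u, v, w) 1) | c u v w. True} \<union>
      {Poly_Mapping.single (u, v, s c w) 1 - free_scale c (Poly_Mapping.single (u, v, w) 1) | c u v w. True})"

text \<open>
  Elements of \<open>V \<otimes> W\<close> are the cosets of \<open>tensor_null\<close> in the free vector space on \<open>V \<times> W\<close>.
  For a linear subspace \<open>W'\<close> of \<open>W\<close>, \<open>tensor_space\<close> is the image of \<open>V \<otimes> W'\<close> in \<open>V \<otimes> W\<close>; over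
  a field \<open>V \<otimes> W'\<close> embeds into \<open>V \<otimes> W\<close>, so this is \<open>V \<otimes> W'\<close> itself.
\<close>

definition tensor_class ::
  "('k::field \<Rightarrow> 'v \<Rightarrow> 'v::ab_group_add) \<Rightarrow> ('k \<Rightarrow> 'w \<Rightarrow> 'w::ab_group_add) \<Rightarrow>
   ('v \<times> 'w \<Rightarrow>\<^sub>0 'k) \<Rightarrow> ('v \<times> 'w \<Rightarrow>\<^sub>0 'k) set" where
  "tensor_class s1 s2 p = {q. q - p \<in> tensor_null s1 s2}"

definition tensor_space ::
  "('k::field \<Rightarrow> 'v \<Rightarrow> 'v::ab_group_add) \<Rightarrow> ('k \<Rightarrow> 'w \<Rightarrow> 'w::ab_group_add) \<Rightarrow>
   'w set \<Rightarrow> ('v \<times> 'w \<Rightarrow>\<^sub>0 'k) set set" where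
  "tensor_space s1 s2 W' = {tensor_class s1 s2 p | p. Poly_Mapping.keys p \<subseteq> UNIV \<times> W'}"

text \<open>
  A chosen expression \<open>t = \<Sum>\<^sub>i c\<^sub>i (v\<^sub>i \<otimes> w\<^sub>i)\<close>. For \<open>t = \<Delta>(x)\<close> it plays the role of the Sweedler
  notation \<open>x\<^sub>(\<^sub>1\<^sub>) \<otimes> x\<^sub>(\<^sub>2\<^sub>)\<close>. Below it only occurs inside expressions that are multilinear in the
  tensor factors (where needed modulo \<open>tensor_null\<close>), so that the values do not depend on the
  choice.
\<close>

definition tensor_rep :: "('v \<times> 'w \<Rightarrow>\<^sub>0 'k::field) set \<Rightarrow> ('v \<times> 'w \<Rightarrow>\<^sub>0 'k)" where
  "tensor_rep t = (SOME p. p \<in> t)"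

definition tensor_add ::
  "('k::field \<Rightarrow> 'v \<Rightarrow> 'v::ab_group_add) \<Rightarrow> ('k \<Rightarrow> 'w \<Rightarrow> 'w::ab_group_add) \<Rightarrow>
   ('v \<times> 'w \<Rightarrow>\<^sub>0 'k) set \<Rightarrow> ('v \<times> 'w \<Rightarrow>\<^sub>0 'k) set \<Rightarrow> ('v \<times> 'w \<Rightarrow>\<^sub>0 'k) set" where
  "tensor_add s1 s2 t u = tensor_class s1 s2 (tensor_rep t + tensor_rep u)"

definition tensor_scale ::
  "('k::field \<Rightarrow> 'v \<Rightarrow> 'v::ab_group_add) \<Rightarrow> ('k \<Rightarrow> 'w \<Rightarrow> 'w::ab_group_add) \<Rightarrow>
   'k \<Rightarrow> ('v \<times> 'w \<Rightarrow>\<^sub>0 'k) set \<Rightarrow> ('v \<times> 'w \<Rightarrow>\<^sub>0 'k) set" where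
  "tensor_scale s1 s2 c t = tensor_class s1 s2 (free_scale c (tensor_rep t))"

text \<open>The tensor product algebra: \<open>(a \<otimes> b)(a' \<otimes> b') = a a' \<otimes> b b'\<close>.\<close>

definition tensor_mult ::
  "('k::field \<Rightarrow> 'v \<Rightarrow> 'v::ring_1) \<Rightarrow> ('k \<Rightarrow> 'w \<Rightarrow> 'w::ring_1) \<Rightarrow>
   ('v \<times> 'w \<Rightarrow>\<^sub>0 'k) set \<Rightarrow> ('v \<times> 'w \<Rightarrow>\<^sub>0 'k) set \<Rightarrow> ('v \<times> 'w \<Rightarrow>\<^sub>0 'k) set" where
  "tensor_mult s1 s2 t u = tensor_class s1 s2
     (free_lift free_scale (\<lambda>(a, b).
        free_lift free_scale (\<lambda>(a', b'). Poly_Mapping.single (a * a', b * b') 1) (tensor_rep u)) (tensor_rep t))"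


section \<open>Hopf algebras and module algebras\<close>

locale k_algebra = vector_space scale
  for scale :: "'k::field \<Rightarrow> 'a::ring_1 \<Rightarrow> 'a" +
  assumes scale_mult_left: "scale c (x * y) = scale c x * y"
    and scale_mult_right: "scale c (x * y) = x * scale c y"

locale hopf_algebra = k_algebra scale
  for scale :: "'k::field \<Rightarrow> 'h::ring_1 \<Rightarrow> 'h"
    and comult :: "'h \<Rightarrow> ('h \<times> 'h \<Rightarrow>\<^sub>0 'k) set"
    and counit :: "'h \<Rightarrow> 'k"
    and antipode :: "'h \<Rightarrow> 'h" +
  assumes comult_in_tensor: "comult x \<in> tensor_space scale scale UNIV"
    and comult_add: "comult (x + y) = tensor_add scale scale (comult x) (comult y)"
    and comult_scale: "comult (scale c x) = tensor_scale scale scale c (comult x)"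
    and comult_mult: "comult (x * y) = tensor_mult scale scale (comult x) (comult y)"
    and comult_one: "comult 1 = tensor_class scale scale (Poly_Mapping.single (1, 1) 1)"
    and coassoc:
      "free_lift free_scale (\<lambda>(a, b).
          free_lift free_scale (\<lambda>(a1, a2). Poly_Mapping.single (a1, a2, b) 1) (tensor_rep (comult a)))
          (tensor_rep (comult x))
       - free_lift free_scale (\<lambda>(a, b).
          free_lift free_scale (\<lambda>(b1, b2). Poly_Mapping.single (a, b1, b2) 1) (tensor_rep (comult b)))
          (tensor_rep (comult x))
       \<in> tensor_null3 scale"
    and counit_linear: "Vector_Spaces.linear scale (*) counit"
    and counit_mult: "counit (x * y) = counit x * counit y"
    and counit_one: "counit 1 = 1"
    and counit_left: "free_lift scale (\<lambda>(a, b). scale (counit a) b) (tensor_rep (comult x)) = x"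
    and counit_right: "free_lift scale (\<lambda>(a, b). scale (counit b) a) (tensor_rep (comult x)) = x"
    and antipode_linear: "Vector_Spaces.linear scale scale antipode"
    and antipode_left:
      "free_lift scale (\<lambda>(a, b). antipode a * b) (tensor_rep (comult x)) = scale (counit x) 1"
    and antipode_right:
      "free_lift scale (\<lambda>(a, b). a * antipode b) (tensor_rep (comult x)) = scale (counit x) 1"

definition left_coideal_subalgebra ::
  "('k::field \<Rightarrow> 'h::ring_1 \<Rightarrow> 'h) \<Rightarrow> ('h \<Rightarrow> ('h \<times> 'h \<Rightarrow>\<^sub>0 'k) set) \<Rightarrow> 'h set \<Rightarrow> bool" where
  "left_coideal_subalgebra scale comult H \<longleftrightarrow>
     module.subspace scale H \<and> 1 \<in> H \<and> (\<forall>x\<in>H. \<forall>y\<in>H. x * y \<in> H) \<and>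
     (\<forall>x\<in>H. comult x \<in> tensor_space scale scale H)"

locale module_algebra =
  hopf_algebra scale comult counit antipode + A: k_algebra scale_A
  for scale :: "'k::field \<Rightarrow> 'h::ring_1 \<Rightarrow> 'h"
    and comult :: "'h \<Rightarrow> ('h \<times> 'h \<Rightarrow>\<^sub>0 'k) set"
    and counit :: "'h \<Rightarrow> 'k"
    and antipode :: "'h \<Rightarrow> 'h"
    and scale_A :: "'k \<Rightarrow> 'a::ring_1 \<Rightarrow> 'a"
    and act :: "'h \<Rightarrow> 'a \<Rightarrow> 'a" +
  assumes act_linear_left: "Vector_Spaces.linear scale scale_A (\<lambda>x. act x a)"
    and act_linear_right: "Vector_Spaces.linear scale_A scale_A (act x)"
    and act_one: "act 1 a = a"
    and act_mult: "act (x * y) a = act x (act y a)"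
    and act_on_one: "act x 1 = scale_A (counit x) 1"
    and act_on_mult:
      "act x (a * b) = free_lift scale_A (\<lambda>(x1, x2). act x1 a * act x2 b) (tensor_rep (comult x))"


section \<open>Smash products\<close>

text \<open>
  The smash product of the module algebra \<open>A\<close> with \<open>H\<close>, on the vector space \<open>A \<otimes> H\<close>, where \<open>a \<otimes> x\<close>
  stands for the product \<open>a x\<close>. Its multiplication is the one forced by the relation
  \<open>x b = (x\<^sub>(\<^sub>1\<^sub>) \<triangleright> b) x\<^sub>(\<^sub>2\<^sub>)\<close>, namely \<open>(a \<otimes> x)(b \<otimes> y) = a (x\<^sub>(\<^sub>1\<^sub>) \<triangleright> b) \<otimes> x\<^sub>(\<^sub>2\<^sub>) y\<close>.
  The operations do not depend on \<open>H\<close>, so for a left coideal subalgebra \<open>H\<close> the smash product with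
  \<open>H\<close> is a subalgebra of the smash product with the whole Hopf algebra, \<open>H = UNIV\<close>.
\<close>

definition smash_mult ::
  "('k::field \<Rightarrow> 'h::ring_1 \<Rightarrow> 'h) \<Rightarrow> ('h \<Rightarrow> ('h \<times> 'h \<Rightarrow>\<^sub>0 'k) set) \<Rightarrow>
   ('k \<Rightarrow> 'a::ring_1 \<Rightarrow> 'a) \<Rightarrow> ('h \<Rightarrow> 'a \<Rightarrow> 'a) \<Rightarrow>
   ('a \<times> 'h \<Rightarrow>\<^sub>0 'k) set \<Rightarrow> ('a \<times> 'h \<Rightarrow>\<^sub>0 'k) set \<Rightarrow> ('a \<times> 'h \<Rightarrow>\<^sub>0 'k) set" where
  "smash_mult scale comult scale_A act X Y = tensor_class scale_A scale
     (free_lift free_scale (\<lambda>(a, x).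
        free_lift free_scale (\<lambda>(b, y).
          free_lift free_scale (\<lambda>(x1, x2). Poly_Mapping.single (a * act x1 b, x2 * y) 1)
            (tensor_rep (comult x)))
          (tensor_rep Y))
        (tensor_rep X))"

definition smash ::
  "('k::field \<Rightarrow> 'h::ring_1 \<Rightarrow> 'h) \<Rightarrow> ('h \<Rightarrow> ('h \<times> 'h \<Rightarrow>\<^sub>0 'k) set) \<Rightarrow>
   ('k \<Rightarrow> 'a::ring_1 \<Rightarrow> 'a) \<Rightarrow> ('h \<Rightarrow> 'a \<Rightarrow> 'a) \<Rightarrow> 'h set \<Rightarrow>
   ('k, ('a \<times> 'h \<Rightarrow>\<^sub>0 'k) set) module" where
  "smash scale comult scale_A act H =
     \<lparr>carrier = tensor_space scale_A scale H,
      mult = smash_mult scale comult scale_A act,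
      one = tensor_class scale_A scale (Poly_Mapping.single (1, 1) 1),
      zero = tensor_class scale_A scale 0,
      add = tensor_add scale_A scale,
      smult = tensor_scale scale_A scale\<rparr>"

text \<open>The embedding \<open>a \<mapsto> a \<otimes> 1\<close> of \<open>A\<close> into the smash product.\<close>

definition smash_embed ::
  "('k::field \<Rightarrow> 'h::ring_1 \<Rightarrow> 'h) \<Rightarrow> ('k \<Rightarrow> 'a::ring_1 \<Rightarrow> 'a) \<Rightarrow> 'a \<Rightarrow> ('a \<times> 'h \<Rightarrow>\<^sub>0 'k) set" where
  "smash_embed scale scale_A a = tensor_class scale_A scale (Poly_Mapping.single (a, 1) 1)"

text \<open>
  The action of the smash product on \<open>A\<close>, \<open>(a \<otimes> x) \<cdot> b = a (x \<triangleright> b)\<close>. For \<open>A = L\<close> this is the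
  endomorphism \<open>X\<close> with a hat.
\<close>

definition smash_act ::
  "('k::field \<Rightarrow> 'a::ring_1 \<Rightarrow> 'a) \<Rightarrow> ('h \<Rightarrow> 'a \<Rightarrow> 'a) \<Rightarrow> ('a \<times> 'h \<Rightarrow>\<^sub>0 'k) set \<Rightarrow> 'a \<Rightarrow> 'a" where
  "smash_act scale_A act X b = free_lift scale_A (\<lambda>(a, x). a * act x b) (tensor_rep X)"


section \<open>Subspaces and subalgebras of an algebra given by a record\<close>

definition is_subspace :: "('k, 's) module \<Rightarrow> 's set \<Rightarrow> bool" where
  "is_subspace S V \<longleftrightarrow> V \<subseteq> carrier S \<and> \<zero>\<^bsub>S\<^esub> \<in> V \<and> (\<forall>X\<in>V. \<forall>Y\<in>V. X \<oplus>\<^bsub>S\<^esub> Y \<in> V) \<and>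
     (\<forall>c. \<forall>X\<in>V. c \<odot>\<^bsub>S\<^esub> X \<in> V)"

definition is_subalgebra :: "('k, 's) module \<Rightarrow> 's set \<Rightarrow> bool" where
  "is_subalgebra S F \<longleftrightarrow> is_subspace S F \<and> \<one>\<^bsub>S\<^esub> \<in> F \<and> (\<forall>X\<in>F. \<forall>Y\<in>F. X \<otimes>\<^bsub>S\<^esub> Y \<in> F)"

definition is_commutative_subalgebra :: "('k, 's) module \<Rightarrow> 's set \<Rightarrow> bool" where
  "is_commutative_subalgebra S C \<longleftrightarrow>
     is_subalgebra S C \<and> (\<forall>X\<in>C. \<forall>Y\<in>C. X \<otimes>\<^bsub>S\<^esub> Y = Y \<otimes>\<^bsub>S\<^esub> X)"

definition maximal_commutative_subalgebra :: "('k, 's) module \<Rightarrow> 's set \<Rightarrow> 's set \<Rightarrow> bool" where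
  "maximal_commutative_subalgebra S F C \<longleftrightarrow>
     is_commutative_subalgebra S C \<and> C \<subseteq> F \<and>
     (\<forall>D. is_commutative_subalgebra S D \<and> C \<subseteq> D \<and> D \<subseteq> F \<longrightarrow> D = C)"


section \<open>Hopf Galois order settings and Galois orders\<close>

definition frac_embed :: "'a::idom \<Rightarrow> 'a fract" where
  "frac_embed a = Fraction_Field.Fract a 1"

definition frac_scale :: "('k::field \<Rightarrow> 'a::idom \<Rightarrow> 'a) \<Rightarrow> 'k \<Rightarrow> 'a fract \<Rightarrow> 'a fract" where
  "frac_scale s c f = frac_embed (s c 1) * f"

text \<open>
  The parameter \<open>H\<close> is the left coideal subalgebra of the ambient Hopf algebra on the type \<open>'h\<close>, the
  domain \<open>\<Lambda>\<close> is the type \<open>'a\<close>, and \<open>act_L\<close> is the extension of the action \<open>act\<close> to the field of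
  fractions \<open>L\<close>, which is again required to be a module algebra.
\<close>

locale hopf_galois_setting =
  Lam: module_algebra scale comult counit antipode scale_Lam act +
  Frac: module_algebra scale comult counit antipode "frac_scale scale_Lam" act_L
  for scale :: "'k::field \<Rightarrow> 'h::ring_1 \<Rightarrow> 'h"
    and comult :: "'h \<Rightarrow> ('h \<times> 'h \<Rightarrow>\<^sub>0 'k) set"
    and counit :: "'h \<Rightarrow> 'k"
    and antipode :: "'h \<Rightarrow> 'h"
    and scale_Lam :: "'k \<Rightarrow> 'a::idom \<Rightarrow> 'a"
    and act :: "'h \<Rightarrow> 'a \<Rightarrow> 'a"
    and act_L :: "'h \<Rightarrow> 'a fract \<Rightarrow> 'a fract"
    and H :: "'h set" +
  assumes antipode_bij: "bij antipode"
    and coideal_subalgebra: "left_coideal_subalgebra scale comult H"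
    and noetherian:
      "noetherian_ring \<lparr>carrier = (UNIV :: 'a set), mult = (*), one = 1, zero = 0, add = (+)\<rparr>"
    and act_extends: "act_L x (frac_embed a) = frac_embed (act x a)"
    and faithful:
      "\<lbrakk>X \<in> carrier (smash scale comult scale_Lam act H); \<And>b. smash_act scale_Lam act X b = 0\<rbrakk>
       \<Longrightarrow> X = \<zero>\<^bsub>smash scale comult scale_Lam act H\<^esub>"

text \<open>
  In \<open>galois_order\<close>, the span of the products \<open>l f\<close> with \<open>l \<in> L\<close> and \<open>f \<in> F\<close> is what is written \<open>L F\<close>.
\<close>

definition galois_order ::
  "('k::field \<Rightarrow> 'h::ring_1 \<Rightarrow> 'h) \<Rightarrow> ('h \<Rightarrow> ('h \<times> 'h \<Rightarrow>\<^sub>0 'k) set) \<Rightarrow>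
   ('k \<Rightarrow> 'a::idom \<Rightarrow> 'a) \<Rightarrow> ('h \<Rightarrow> 'a fract \<Rightarrow> 'a fract) \<Rightarrow> 'h set \<Rightarrow>
   ('a fract \<times> 'h \<Rightarrow>\<^sub>0 'k) set set \<Rightarrow> bool" where
  "galois_order scale comult scale_Lam act_L H F \<longleftrightarrow>
     (let S = smash scale comult (frac_scale scale_Lam) act_L H;
          \<iota> = smash_embed scale (frac_scale scale_Lam) in
       is_subalgebra S F \<and>
       \<iota> ` range frac_embed \<subseteq> F \<and>
       is_subspace S hull {\<iota> l \<otimes>\<^bsub>S\<^esub> X | l X. X \<in> F} = carrier S \<and>
       (\<forall>X\<in>F. smash_act (frac_scale scale_Lam) act_L X ` range frac_embed \<subseteq> range frac_embed))"

end

theory Submission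
  imports Defs
begin

text \<open>
  An element \<open>X\<close> of \<open>F\<close> commuting with \<open>\<Lambda>\<close> acts on \<open>\<Lambda>\<close> as multiplication by \<open>f\<close>, the value of
  \<open>X\<close> at \<open>1\<close>, which lies in \<open>\<Lambda>\<close>. So \<open>X - f\<close> annihilates \<open>\<Lambda>\<close>. Multiplying by a common denominator
  \<open>d\<close> of its coefficients gives an element of \<open>\<Lambda> # H\<close> which annihilates \<open>\<Lambda>\<close> and hence vanishes by
  faithfulness; dividing by \<open>d\<close> in \<open>L # H\<close> gives \<open>X = f\<close>.
\<close>

section \<open>Linear extension from a basis of a free vector space\<close>

lemma free_lift_superset:
  assumes "vector_space s" "finite A" "Poly_Mapping.keys p \<subseteq> A"
  shows "free_lift s f p = (\<Sum>i\<in>A. s (Poly_Mapping.lookup p i) (f i))"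
proof -
  interpret vector_space s by fact
  show ?thesis
    unfolding free_lift_def
    by (rule sum.mono_neutral_left) (use assms in \<open>auto simp: in_keys_iff\<close>)
qed

lemma lookup_free_scale: "Poly_Mapping.lookup (free_scale c p) i = c * Poly_Mapping.lookup p i"
  by (simp add: free_scale_def Poly_Mapping.map.rep_eq when_def in_keys_iff)

lemma linear_free_lift:
  assumes "vector_space s"
  shows "Vector_Spaces.linear free_scale s (free_lift s f)"
proof -
  interpret vector_space s by fact
  have "free_lift s f (p + q) = free_lift s f p + free_lift s f q" for p q
  proof -
    \<comment> \<open>Cancellation may shrink the support of \<open>p + q\<close>, so all three sums
      are taken over the union of the supports.\<close>
    let ?A = "Poly_Mapping.keys p \<union> Poly_Mapping.keys q"
    have "Poly_Mapping.keys (p + q) \<subseteq> ?A"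
      by (rule Poly_Mapping.keys_add)
    then show ?thesis
      by (simp add: free_lift_superset[OF assms, of ?A] lookup_add scale_left_distrib sum.distrib)
  qed
  moreover have "free_lift s f (free_scale c p) = s c (free_lift s f p)" for c p
  proof -
    have "Poly_Mapping.keys (free_scale c p) \<subseteq> Poly_Mapping.keys p"
      by (auto simp: in_keys_iff lookup_free_scale)
    then show ?thesis
      by (simp add: free_lift_superset[OF assms, of "Poly_Mapping.keys p"] lookup_free_scale
          scale_sum_right)
  qed
  ultimately show ?thesis
    by (intro Vector_Spaces.linear.intro module_hom.intro module_hom_axioms.intro free.module_axioms
        module_axioms free.vector_space_axioms assms)
qed

lemma free_lift_single:
  assumes "vector_space s"
  shows "free_lift s f (Poly_Mapping.single i c) = s c (f i)"
proof -
  interpret vector_space s by fact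
  show ?thesis
    by (simp add: free_lift_def)
qed

lemma free_lift_cong:
  "(\<And>i. i \<in> Poly_Mapping.keys p \<Longrightarrow> f i = g i) \<Longrightarrow> free_lift s f p = free_lift s g p"
  by (simp add: free_lift_def)

text \<open>Pushes a linear map into a formal sum. With \<open>g\<close> itself a
  \<open>free_lift\<close> it collapses nested lifts, which is how the Sweedler-style expressions
  below are evaluated.\<close>

lemma linear_free_lift_comp:
  assumes "Vector_Spaces.linear s s' g"
  shows "g (free_lift s f p) = free_lift s' (\<lambda>i. g (f i)) p"
proof -
  interpret Vector_Spaces.linear s s' g by fact
  show ?thesis
    by (simp add: free_lift_def sum scale)
qed

lemma free_lift_free_single:
  fixes p :: "'i \<Rightarrow>\<^sub>0 'k::field"
  shows "free_lift free_scale (\<lambda>i. Poly_Mapping.single i 1) p = p"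
proof -
  have "free_scale c (Poly_Mapping.single i 1) = Poly_Mapping.single i c" for c :: 'k and i :: 'i
    by (rule poly_mapping_eqI) (simp add: lookup_free_scale lookup_single when_def)
  then show ?thesis
    by (intro poly_mapping_eqI)
      (simp add: free_lift_def lookup_sum lookup_single when_def in_keys_iff)
qed

section \<open>Tensor products: cosets and maps out of them\<close>

lemma free_lift_tensor_null:
  assumes vs: "vector_space s" and T: "module.subspace s T"
    and "\<And>v v' w. f (v + v', w) - f (v, w) - f (v', w) \<in> T"
    and "\<And>v w w'. f (v, w + w') - f (v, w) - f (v, w') \<in> T"
    and "\<And>c v w. f (s1 c v, w) - s c (f (v, w)) \<in> T"
    and "\<And>c v w. f (v, s2 c w) - s c (f (v, w)) \<in> T"
    and p: "p \<in> tensor_null s1 s2"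
  shows "free_lift s f p \<in> T"
proof -
  interpret vector_space s by fact
  interpret lift: Vector_Spaces.linear free_scale s "free_lift s f"
    by (rule linear_free_lift) fact
  \<comment> \<open>The preimage of \<open>T\<close> under a linear map is a subspace, so only the
    four families of generators need checking. This is the universal property of the tensor product:
    with \<open>T = {0}\<close> it shows independence of the representative, with \<open>T\<close>
    another \<open>tensor_null\<close> it induces a map of tensor products.\<close>
  have "free.subspace (free_lift s f -` T)"
    using lift.subspace_vimage[OF T] by simp
  then have "tensor_null s1 s2 \<subseteq> free_lift s f -` T"
    unfolding tensor_null_def
    by (intro free.span_minimal)
      (use assms(3-6) in \<open>auto simp: lift.diff lift.scale free_lift_single[OF vs]\<close>)
  with p show ?thesis by blast
qed

lemma subspace_tensor_null: "free.subspace (tensor_null s1 s2)"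
  by (simp add: tensor_null_def)

lemma
  shows tensor_null_add_left:
      "Poly_Mapping.single (v + v', w) 1 - Poly_Mapping.single (v, w) 1 - Poly_Mapping.single (v', w) 1
        \<in> tensor_null s1 s2"
    and tensor_null_add_right:
      "Poly_Mapping.single (v, w + w') 1 - Poly_Mapping.single (v, w) 1 - Poly_Mapping.single (v, w') 1
        \<in> tensor_null s1 s2"
    and tensor_null_scale_left:
      "Poly_Mapping.single (s1 c v, w) 1 - free_scale c (Poly_Mapping.single (v, w) 1) \<in> tensor_null s1 s2"
    and tensor_null_scale_right:
      "Poly_Mapping.single (v, s2 c w) 1 - free_scale c (Poly_Mapping.single (v, w) 1) \<in> tensor_null s1 s2"
  unfolding tensor_null_def by (rule free.span_base; blast)+

lemma tensor_class_eq_iff: "tensor_class s1 s2 p = tensor_class s1 s2 q \<longleftrightarrow> p - q \<in> tensor_null s1 s2"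
proof
  assume "tensor_class s1 s2 p = tensor_class s1 s2 q"
  moreover have "p \<in> tensor_class s1 s2 p"
    by (simp add: tensor_class_def free.subspace_0[OF subspace_tensor_null])
  ultimately show "p - q \<in> tensor_null s1 s2"
    by (simp add: tensor_class_def)
next
  assume *: "p - q \<in> tensor_null s1 s2"
  have "r - p \<in> tensor_null s1 s2 \<longleftrightarrow> r - q \<in> tensor_null s1 s2" for r
    using free.subspace_add[OF subspace_tensor_null _ *, of "r - p"]
      free.subspace_diff[OF subspace_tensor_null _ *, of "r - q"] by auto
  then show "tensor_class s1 s2 p = tensor_class s1 s2 q"
    by (simp add: tensor_class_def)
qed

text \<open>The coset contains \<open>p\<close>, so \<open>SOME\<close> picks a member of it.
  Nothing more is known about the choice; this suffices wherever null elements are sent to null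
  elements or to \<open>0\<close>.\<close>

lemma tensor_rep_class: "tensor_rep (tensor_class s1 s2 p) - p \<in> tensor_null s1 s2"
proof -
  have "p \<in> tensor_class s1 s2 p"
    by (simp add: tensor_class_def free.subspace_0[OF subspace_tensor_null])
  then have "tensor_rep (tensor_class s1 s2 p) \<in> tensor_class s1 s2 p"
    unfolding tensor_rep_def by (rule someI)
  then show ?thesis
    by (simp add: tensor_class_def)
qed

lemma tensor_class_single_add_left:
  "tensor_class s1 s2 (Poly_Mapping.single (v, w) 1 + Poly_Mapping.single (v', w) 1) =
   tensor_class s1 s2 (Poly_Mapping.single (v + v', w) 1)"
  by (subst eq_commute) (use tensor_null_add_left in \<open>simp add: tensor_class_eq_iff algebra_simps\<close>)

lemma tensor_class_single_scale_left:
  "tensor_class s1 s2 (free_scale c (Poly_Mapping.single (v, w) 1)) =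
   tensor_class s1 s2 (Poly_Mapping.single (s1 c v, w) 1)"
  by (subst eq_commute) (simp add: tensor_class_eq_iff tensor_null_scale_left)

lemma tensor_add_class:
  "tensor_add s1 s2 (tensor_class s1 s2 p) (tensor_class s1 s2 q) = tensor_class s1 s2 (p + q)"
  using free.subspace_add[OF subspace_tensor_null tensor_rep_class tensor_rep_class, of s1 s2 p q]
  by (simp add: tensor_add_def tensor_class_eq_iff algebra_simps)

lemma tensor_scale_class:
  "tensor_scale s1 s2 c (tensor_class s1 s2 p) = tensor_class s1 s2 (free_scale c p)"
  using free.subspace_scale[OF subspace_tensor_null tensor_rep_class, of c s1 s2 p]
  by (simp add: tensor_scale_def tensor_class_eq_iff free.scale_right_diff_distrib)

section \<open>The action of the smash product on the module algebra\<close>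

lemma (in k_algebra) linear_mult_left: "Vector_Spaces.linear scale scale ((*) a)"
  by unfold_locales (auto simp: algebra_simps scale_mult_right)

context module_algebra
begin

text \<open>Since \<open>a * act x b\<close> is bilinear in \<open>a\<close> and \<open>x\<close>,
  its lift kills \<open>tensor_null\<close>, and any representative computes the action.\<close>

lemma smash_act_class:
  "smash_act scale_A act (tensor_class scale_A scale p) b = free_lift scale_A (\<lambda>(a, x). a * act x b) p"
proof -
  let ?f = "\<lambda>(a, x). a * act x b"
  interpret left: Vector_Spaces.linear scale scale_A "\<lambda>x. act x b"
    by (rule act_linear_left)
  interpret lift: Vector_Spaces.linear free_scale scale_A "free_lift scale_A ?f"
    by (rule linear_free_lift) unfold_locales
  have "free_lift scale_A ?f (tensor_rep (tensor_class scale_A scale p) - p) \<in> {0}"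
    by (rule free_lift_tensor_null[OF _ _ _ _ _ _ tensor_rep_class])
      (auto simp: A.vector_space_axioms left.add left.scale algebra_simps
        A.scale_mult_left[symmetric] A.scale_mult_right[symmetric])
  then show ?thesis
    by (simp add: smash_act_def lift.diff)
qed

lemma smash_act_embed: "smash_act scale_A act (smash_embed scale scale_A a) b = a * b"
  by (simp add: smash_embed_def smash_act_class free_lift_single[OF A.vector_space_axioms] act_one)

text \<open>Composition of actions matches the smash product because of the module algebra law for
  \<open>act x\<close> on a product. Both sides use the same representatives of \<open>X\<close> and
  \<open>Y\<close>, so only the class of the product has to be evaluated.\<close>

lemma smash_act_mult:
  "smash_act scale_A act (smash_mult scale comult scale_A act X Y) g =
   smash_act scale_A act X (smash_act scale_A act Y g)"
proof -
  let ?l = "\<lambda>p. fst p * act (snd p) g"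
  have lift: "Vector_Spaces.linear free_scale scale_A (free_lift scale_A ?l)"
    by (rule linear_free_lift) unfold_locales
  \<comment> \<open>The Sweedler sum over \<open>comult x\<close> is \<open>act_on_mult\<close> read
    backwards, applied to \<open>b\<close> and \<open>act y g\<close>.\<close>
  have inner: "free_lift scale_A (\<lambda>(x1, x2). a * act x1 b * act (x2 * y) g) (tensor_rep (comult x)) =
      a * act x (b * act y g)" for a b x y
    by (simp add: act_on_mult act_mult linear_free_lift_comp[OF A.linear_mult_left]
        case_prod_unfold mult.assoc)
  have outer: "free_lift scale_A (\<lambda>(b, y). a * act x (b * act y g)) (tensor_rep Y) =
      a * act x (smash_act scale_A act Y g)" for a x
    by (simp add: smash_act_def linear_free_lift_comp[OF act_linear_right]
        linear_free_lift_comp[OF A.linear_mult_left] case_prod_unfold)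
  have "smash_act scale_A act (smash_mult scale comult scale_A act X Y) g =
    free_lift scale_A (\<lambda>(a, x). free_lift scale_A (\<lambda>(b, y).
      free_lift scale_A (\<lambda>(x1, x2). a * act x1 b * act (x2 * y) g) (tensor_rep (comult x)))
      (tensor_rep Y)) (tensor_rep X)"
    by (simp add: smash_mult_def smash_act_class linear_free_lift_comp[OF lift] case_prod_unfold
        free_lift_single[OF A.vector_space_axioms])
  then show ?thesis
    by (simp add: inner outer smash_act_def[of _ _ X])
qed

end

section \<open>The embedding into the fraction field and common denominators\<close>

lemma frac_embed_add: "frac_embed (a + b) = frac_embed a + frac_embed b"
  by (simp add: frac_embed_def)

lemma frac_embed_mult: "frac_embed (a * b) = frac_embed a * frac_embed b"
  by (simp add: frac_embed_def)

lemma frac_embed_0: "frac_embed 0 = 0"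
  by (simp add: frac_embed_def Zero_fract_def)

lemma frac_embed_1: "frac_embed 1 = 1"
  by (simp add: frac_embed_def One_fract_def)

lemma frac_embed_eq_0_iff: "frac_embed a = 0 \<longleftrightarrow> a = 0"
  by (simp add: frac_embed_def Zero_fract_def eq_fract)

text \<open>Induction on the set, multiplying the denominator found so far by that of the new
  element. The numerators form a function \<open>n\<close>, so that they can later replace left
  tensor factors one at a time.\<close>

lemma common_denominator:
  fixes A :: "'a::idom fract set"
  assumes "finite A"
  shows "\<exists>d n. d \<noteq> 0 \<and> (\<forall>a\<in>A. frac_embed d * a = frac_embed (n a))"
  using assms
proof (induction A)
  case empty
  then show ?case by (auto intro: exI[of _ 1])
next
  case (insert x A)
  then obtain d n where d: "d \<noteq> 0" "\<And>a. a \<in> A \<Longrightarrow> frac_embed d * a = frac_embed (n a)"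
    by blast
  obtain r s where s: "x = Fraction_Field.Fract r s" "s \<noteq> 0"
    by (cases x)
  have "frac_embed s * x = frac_embed r"
    using s by (simp add: frac_embed_def eq_fract)
  then have "frac_embed (d * s) * x = frac_embed (d * r)"
    by (simp add: frac_embed_mult mult.assoc)
  moreover have "frac_embed (d * s) * a = frac_embed (s * n a)" if "a \<in> A" for a
    using d(2)[OF that] by (simp add: frac_embed_mult algebra_simps)
  ultimately have "\<forall>a\<in>insert x A. frac_embed (d * s) * a = frac_embed (if a = x then d * r else s * n a)"
    by auto
  moreover have "d * s \<noteq> 0"
    using d s by simp
  ultimately show ?case
    by (intro exI[of _ "d * s"] exI[of _ "\<lambda>a. if a = x then d * r else s * n a"]) blast
qed

section \<open>Faithfulness carried over to the fraction field\<close>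

context hopf_galois_setting
begin

lemma linear_frac_embed: "Vector_Spaces.linear scale_Lam (frac_scale scale_Lam) frac_embed"
proof -
  have "frac_embed (scale_Lam c a) = frac_scale scale_Lam c (frac_embed a)" for c a
    using Lam.A.scale_mult_left[of c 1 a] by (simp add: frac_scale_def flip: frac_embed_mult)
  then show ?thesis
    by unfold_locales (auto simp: frac_embed_add)
qed

text \<open>Extends \<open>faithful\<close> from \<Lambda> to L, still testing on \<Lambda> alone.
  It speaks of a representative \<open>q\<close> rather than a class, because denominators are
  cleared on the finitely many left factors occurring in \<open>q\<close>.\<close>

lemma tensor_null_of_annihilates:
  assumes keys: "Poly_Mapping.keys q \<subseteq> UNIV \<times> H"
    and annihilates: "\<And>b. free_lift (frac_scale scale_Lam) (\<lambda>(a, x). a * act_L x (frac_embed b)) q = 0"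
  shows "q \<in> tensor_null (frac_scale scale_Lam) scale"
proof -
  obtain d n where d: "d \<noteq> 0" and
    n: "\<And>a x. (a, x) \<in> Poly_Mapping.keys q \<Longrightarrow> frac_embed (n a) = frac_embed d * a"
    using common_denominator[of "fst ` Poly_Mapping.keys q"] by fastforce
  \<comment> \<open>\<open>z\<close> stands for \<open>d\<close> times \<open>q\<close>, with its
    left factors pulled back from L to \<Lambda>. The right factors are untouched and hence stay in
    \<open>H\<close>.\<close>
  define z where "z = free_lift free_scale (\<lambda>(a, x). Poly_Mapping.single (n a, x) 1) q"
  have "Poly_Mapping.keys z \<subseteq> UNIV \<times> H"
  proof -
    have "Poly_Mapping.keys z \<subseteq>
        (\<Union>i\<in>Poly_Mapping.keys q. Poly_Mapping.keys (free_scale (Poly_Mapping.lookup q i)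
          (case i of (a, x) \<Rightarrow> Poly_Mapping.single (n a, x) 1)))"
      unfolding z_def free_lift_def by (rule Poly_Mapping.keys_sum)
    also have "\<dots> \<subseteq> UNIV \<times> H"
      using keys by (force simp: in_keys_iff lookup_free_scale lookup_single when_def split: if_splits)
    finally show ?thesis .
  qed
  then have "tensor_class scale_Lam scale z \<in> carrier (smash scale comult scale_Lam act H)"
    by (auto simp: smash_def tensor_space_def)
  moreover have "smash_act scale_Lam act (tensor_class scale_Lam scale z) b = 0" for b
  proof -
    \<comment> \<open>The vanishing is checked inside L, where the value is \<open>d\<close> times
      that of \<open>q\<close>; injectivity of \<open>frac_embed\<close> then brings it back to
      \<Lambda>.\<close>
    have "frac_embed (free_lift scale_Lam (\<lambda>(a, x). a * act x b) z) =
        free_lift (frac_scale scale_Lam) (\<lambda>(a, x). frac_embed (n a) * act_L x (frac_embed b)) q"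
      by (simp add: z_def linear_free_lift_comp[OF linear_free_lift] linear_free_lift_comp[OF linear_frac_embed]
          Lam.A.vector_space_axioms free_lift_single case_prod_unfold frac_embed_mult act_extends)
    also have "\<dots> = free_lift (frac_scale scale_Lam)
        (\<lambda>(a, x). frac_embed d * (a * act_L x (frac_embed b))) q"
      by (rule free_lift_cong) (auto simp: n mult.assoc)
    also have "\<dots> = frac_embed d * free_lift (frac_scale scale_Lam) (\<lambda>(a, x). a * act_L x (frac_embed b)) q"
      by (simp add: linear_free_lift_comp[OF Frac.A.linear_mult_left] case_prod_unfold)
    finally show ?thesis
      by (simp add: Lam.smash_act_class annihilates frac_embed_eq_0_iff)
  qed
  ultimately have "tensor_class scale_Lam scale z = tensor_class scale_Lam scale 0"
    using faithful by (simp add: smash_def)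
  then have z: "z \<in> tensor_null scale_Lam scale"
    by (simp add: tensor_class_eq_iff)
  \<comment> \<open>Division by \<open>d\<close> is a linear map from \<Lambda> to L. Applied to
    left factors it respects the tensor relations, so it sends the null element \<open>z\<close> to
    a null element over L.\<close>
  let ?e = "\<lambda>a. inverse (frac_embed d) * frac_embed a"
  let ?f = "\<lambda>(a, x). Poly_Mapping.single (?e a, x) 1"
  interpret embed: Vector_Spaces.linear scale_Lam "frac_scale scale_Lam" frac_embed
    by (rule linear_frac_embed)
  have "free_lift free_scale ?f z \<in> tensor_null (frac_scale scale_Lam) scale"
  proof (rule free_lift_tensor_null[OF free.vector_space_axioms subspace_tensor_null _ _ _ _ z])
    fix v v' w
    show "?f (v + v', w) - ?f (v, w) - ?f (v', w) \<in> tensor_null (frac_scale scale_Lam) scale"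
      by (simp add: frac_embed_add distrib_left tensor_null_add_left)
  next
    fix v w w'
    show "?f (v, w + w') - ?f (v, w) - ?f (v, w') \<in> tensor_null (frac_scale scale_Lam) scale"
      by (simp add: tensor_null_add_right)
  next
    fix c v w
    have "?e (scale_Lam c v) = frac_scale scale_Lam c (?e v)"
      by (simp add: embed.scale Frac.A.scale_mult_right)
    then show "?f (scale_Lam c v, w) - free_scale c (?f (v, w)) \<in> tensor_null (frac_scale scale_Lam) scale"
      by (simp add: tensor_null_scale_left)
  next
    fix c v w
    show "?f (v, scale c w) - free_scale c (?f (v, w)) \<in> tensor_null (frac_scale scale_Lam) scale"
      by (simp add: tensor_null_scale_right)
  qed
  \<comment> \<open>Dividing undoes the clearing of denominators on each basis element in the
    support, so \<open>q\<close> is recovered exactly and not only modulo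
    \<open>tensor_null\<close>.\<close>
  moreover have "free_lift free_scale ?f z = q"
  proof -
    have "?e (n a) = a" if "(a, x) \<in> Poly_Mapping.keys q" for a x
      using d by (simp add: n[OF that] frac_embed_eq_0_iff flip: mult.assoc)
    then have "free_lift free_scale (\<lambda>(a, x). ?f (n a, x)) q =
        free_lift free_scale (\<lambda>i. Poly_Mapping.single i 1) q"
      by (intro free_lift_cong) auto
    then show ?thesis
      by (simp add: z_def linear_free_lift_comp[OF linear_free_lift] free.vector_space_axioms
          free_lift_single case_prod_unfold free_lift_free_single)
  qed
  ultimately show ?thesis by simp
qed

section \<open>Maximality of \<Lambda>\<close>

lemma one_mem: "1 \<in> H"
  using coideal_subalgebra by (simp add: left_coideal_subalgebra_def)

text \<open>The difference of \<open>X\<close> and \<open>f\<close> \<otimes> 1 annihilates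
  \<Lambda>, hence vanishes. This serves both to compute products inside \<Lambda> and to identify
  elements commuting with \<Lambda>.\<close>

lemma eq_smash_embed:
  assumes "X \<in> tensor_space (frac_scale scale_Lam) scale H"
    and act_X: "\<And>b. smash_act (frac_scale scale_Lam) act_L X (frac_embed b) = f * frac_embed b"
  shows "X = smash_embed scale (frac_scale scale_Lam) f"
proof -
  obtain p where p: "Poly_Mapping.keys p \<subseteq> UNIV \<times> H" "X = tensor_class (frac_scale scale_Lam) scale p"
    using assms by (auto simp: tensor_space_def)
  let ?q = "p - Poly_Mapping.single (f, 1) 1"
  have "?q \<in> tensor_null (frac_scale scale_Lam) scale"
  proof (rule tensor_null_of_annihilates)
    \<comment> \<open>The subtracted term has right factor \<open>1\<close>, which lies in
      \<open>H\<close>.\<close>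
    have "Poly_Mapping.keys ?q \<subseteq> insert (f, 1) (Poly_Mapping.keys p)"
      by (auto simp: in_keys_iff lookup_minus lookup_single when_def split: if_splits)
    with p(1) one_mem show "Poly_Mapping.keys ?q \<subseteq> UNIV \<times> H"
      by blast
  next
    fix b
    let ?l = "\<lambda>(a, x). a * act_L x (frac_embed b)"
    interpret lift: Vector_Spaces.linear free_scale "frac_scale scale_Lam"
      "free_lift (frac_scale scale_Lam) ?l"
      by (rule linear_free_lift) unfold_locales
    show "free_lift (frac_scale scale_Lam) ?l ?q = 0"
      using act_X[of b]
      by (simp add: p(2) Frac.smash_act_class lift.diff free_lift_single[OF Frac.A.vector_space_axioms]
          Frac.act_one)
  qed
  then show ?thesis
    by (simp add: p(2) smash_embed_def tensor_class_eq_iff)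
qed

lemma maximal_commutative:
  assumes order: "galois_order scale comult scale_Lam act_L H F"
  shows "maximal_commutative_subalgebra (smash scale comult (frac_scale scale_Lam) act_L H) F
    (smash_embed scale (frac_scale scale_Lam) ` range frac_embed)"
proof -
  let ?S = "smash scale comult (frac_scale scale_Lam) act_L H"
  let ?iota = "smash_embed scale (frac_scale scale_Lam)"
  let ?hat = "smash_act (frac_scale scale_Lam) act_L"
  have F: "is_subalgebra ?S F" and Lam_F: "?iota ` range frac_embed \<subseteq> F"
    and hat_F: "\<And>X b. X \<in> F \<Longrightarrow> ?hat X (frac_embed b) \<in> range frac_embed"
    using order by (simp_all add: galois_order_def Let_def image_subset_iff)
  have F_carrier: "F \<subseteq> tensor_space (frac_scale scale_Lam) scale H"
    using F by (simp add: is_subalgebra_def is_subspace_def smash_def)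
  \<comment> \<open>Both sides act on \<Lambda> as multiplication by \<open>a * b\<close>, which
    avoids expanding \<open>comult 1\<close>. Closure of \<open>F\<close> under products puts the
    left side in L # H.\<close>
  have mult: "?iota (frac_embed a) \<otimes>\<^bsub>?S\<^esub> ?iota (frac_embed b) = ?iota (frac_embed (a * b))" for a b
  proof (rule eq_smash_embed)
    have "?iota (frac_embed a) \<otimes>\<^bsub>?S\<^esub> ?iota (frac_embed b) \<in> F"
      using F Lam_F by (simp add: is_subalgebra_def image_subset_iff)
    then show "?iota (frac_embed a) \<otimes>\<^bsub>?S\<^esub> ?iota (frac_embed b) \<in> tensor_space (frac_scale scale_Lam) scale H"
      using F_carrier by blast
  qed (simp add: smash_def Frac.smash_act_mult Frac.smash_act_embed frac_embed_mult mult.assoc)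
  have add: "?iota (frac_embed a) \<oplus>\<^bsub>?S\<^esub> ?iota (frac_embed b) = ?iota (frac_embed (a + b))" for a b
    by (simp add: smash_def smash_embed_def tensor_add_class tensor_class_single_add_left frac_embed_add)
  \<comment> \<open>A scalar acts as the element \<open>scale_Lam c 1\<close> of \<Lambda>, so
    scalar multiples do not leave \<Lambda>.\<close>
  have smult: "c \<odot>\<^bsub>?S\<^esub> ?iota (frac_embed a) = ?iota (frac_embed (scale_Lam c 1 * a))" for c a
    by (simp add: smash_def smash_embed_def tensor_scale_class tensor_class_single_scale_left
        frac_scale_def frac_embed_mult)
  have zero: "\<zero>\<^bsub>?S\<^esub> = ?iota (frac_embed 0)"
    \<comment> \<open>The instance says that 0 \<otimes> 1 added to itself is 0 \<otimes> 1;
      cancelling one copy shows that it is null.\<close>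
    using tensor_class_single_add_left[of "frac_scale scale_Lam" scale 0 1 0]
    by (subst eq_commute) (simp add: smash_def smash_embed_def frac_embed_0 tensor_class_eq_iff)
  have one: "\<one>\<^bsub>?S\<^esub> = ?iota (frac_embed 1)"
    by (simp add: smash_def smash_embed_def frac_embed_1)
  have "is_commutative_subalgebra ?S (?iota ` range frac_embed)"
    unfolding is_commutative_subalgebra_def is_subalgebra_def is_subspace_def
  proof (intro conjI)
    show "?iota ` range frac_embed \<subseteq> carrier ?S"
      using Lam_F F_carrier by (auto simp: smash_def)
  qed (auto simp: mult add smult zero one mult.commute)
  moreover have "D = ?iota ` range frac_embed"
    if D: "is_commutative_subalgebra ?S D" "?iota ` range frac_embed \<subseteq> D" "D \<subseteq> F" for D
  proof
    show "D \<subseteq> ?iota ` range frac_embed"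
    proof
      fix X
      assume X: "X \<in> D"
      \<comment> \<open>Evaluate the commutation relation at \<open>1\<close>: one side gives the
        value of \<open>X\<close> at \<open>b\<close>, the other gives \<open>b\<close> times its
        value at \<open>1\<close>.\<close>
      have "?hat X (frac_embed b) = ?hat X 1 * frac_embed b" for b
      proof -
        have "X \<otimes>\<^bsub>?S\<^esub> ?iota (frac_embed b) = ?iota (frac_embed b) \<otimes>\<^bsub>?S\<^esub> X"
          using D X by (simp add: is_commutative_subalgebra_def image_subset_iff)
        then have "?hat (X \<otimes>\<^bsub>?S\<^esub> ?iota (frac_embed b)) 1 = ?hat (?iota (frac_embed b) \<otimes>\<^bsub>?S\<^esub> X) 1"
          by simp
        then show ?thesis
          by (simp add: smash_def Frac.smash_act_mult Frac.smash_act_embed mult.commute)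
      qed
      then have "X = ?iota (?hat X 1)"
        using X D F_carrier by (intro eq_smash_embed) auto
      \<comment> \<open>Here the defining condition that elements of \<open>F\<close> preserve
        \<Lambda> enters, applied to the element \<open>1\<close> of \<Lambda>.\<close>
      moreover have "?hat X 1 \<in> range frac_embed"
        using hat_F[of X 1] X D by (auto simp: frac_embed_1)
      ultimately show "X \<in> ?iota ` range frac_embed"
        by blast
    qed
  qed (use D in blast)
  ultimately show ?thesis
    using Lam_F by (simp add: maximal_commutative_subalgebra_def)
qed

end

theorem lemma3p12:
  fixes scale :: "'k::field \<Rightarrow> 'h::ring_1 \<Rightarrow> 'h"
    and comult :: "'h \<Rightarrow> ('h \<times> 'h \<Rightarrow>\<^sub>0 'k) set"
    and counit :: "'h \<Rightarrow> 'k"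
    and antipode :: "'h \<Rightarrow> 'h"
    and scale_Lam :: "'k \<Rightarrow> 'a::idom \<Rightarrow> 'a"
    and act :: "'h \<Rightarrow> 'a \<Rightarrow> 'a"
    and act_L :: "'h \<Rightarrow> 'a fract \<Rightarrow> 'a fract"
    and H :: "'h set"
    and F :: "('a fract \<times> 'h \<Rightarrow>\<^sub>0 'k) set set"
  assumes "hopf_galois_setting scale comult counit antipode scale_Lam act act_L H"
    and "galois_order scale comult scale_Lam act_L H F"
  shows "maximal_commutative_subalgebra
           (smash scale comult (frac_scale scale_Lam) act_L H) F
           (smash_embed scale (frac_scale scale_Lam) ` range frac_embed)"
  using assms by (rule hopf_galois_setting.maximal_commutative)

end
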